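(* Let $f=f(\mathbf{w}_1,\mathbf{w}_2,\ldots,\mathbf{w}_L)$ denote a neural network function (a function of the input $x$) parameterized by the weight matrices $\mathbf{w}_l$ of the $l$-th layer, $1\le l\le L$. Suppose there are positive numbers $\lambda_1,\ldots,\lambda_L$ such that $$f(\mathbf{w}_1,\mathbf{w}_2,\ldots,\mathbf{w}_L)=f(\lambda_1\mathbf{w}_1,\lambda_2\mathbf{w}_2,\ldots,\lambda_L\mathbf{w}_L)$$ as functions of the input, for all weight matrices $\mathbf{w}_1,\ldots,\mathbf{w}_L$. Then, with $\mathbf{w}=(\mathbf{w}_1,\ldots,\mathbf{w}_L)$ and $\mathbf{w}^\lambda=(\lambda_1\mathbf{w}_1,\ldots,\lambda_L\mathbf{w}_L)$, we have $$\kappa^l(\mathbf{w})=\kappa^l(\mathbf{w}^\lambda)\quad\text{for all } 1\le l\le L,$$ where $\kappa^l(\mathbf{w})=\|\mathbf{w}_l\|^2\cdot\lambda_{max}^{H,l}(\mathbf{w}_l)$ is the layer-wise flatness measure.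
   Context: Neural network function: for layer widths $n_0,\ldots,n_L$, weight matrices $\mathbf{w}_l\in\mathbb{R}^{n_l\times n_{l-1}}$, fixed bias vectors $b_l\in\mathbb{R}^{n_l}$ and an activation function $\sigma:\mathbb{R}\to\mathbb{R}$ applied coordinatewise, the network with $L$ layers is $$f(x)=f(x;\mathbf{w}_1,\ldots,\mathbf{w}_L)=\mathbf{w}_L\,\sigma(\ldots\sigma(\mathbf{w}_2\,\sigma(\mathbf{w}_1x+b_1)+b_2)\ldots)+b_L,\qquad x\in\mathcal{X}=\mathbb{R}^{n_0},$$ with values in $\mathcal{Y}=\mathbb{R}^{n_L}$. Empirical error: fix a loss function $\ell:\mathcal{Y}\times\mathcal{Y}\to\mathbb{R}_+$ and a finite nonempty training set $S\subset\mathcal{X}\times\mathcal{Y}$. The empirical error at $\mathbf{w}=(\mathbf{w}_1,\ldots,\mathbf{w}_L)$ is $$\mathcal{E}_{emp}(\mathbf{w})=\frac{1}{|S|}\sum_{(x,y)\in S}\ell(f(x;\mathbf{w}_1,\ldots,\mathbf{w}_L),y).$$ Standing assumption: for each $l$ and each choice of the weights of the other layers, the empirical error is twice differentiable as a function of the entries of $\mathbf{w}_l$, so that the Hessian is defined and symmetric. Flatness measure of layer $l$: $\kappa^l(\mathbf{w}):=\|\mathbf{w}_l\|^2\cdot\lambda_{max}^{H,l}(\mathbf{w}_l)$, where $\|\mathbf{w}_l\|$ is the Euclidean norm of the vectorized matrix $\mathbf{w}_l$ (i.e. the Frobenius norm), and $\lambda_{max}^{H,l}(\mathbf{w}_l)$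 is the largest eigenvalue of the Hessian of the empirical error with respect to the entries of $\mathbf{w}_l$ only (weights of all other layers held fixed at their values in $\mathbf{w}$), evaluated at $\mathbf{w}$. In particular, $\kappa^l(\mathbf{w}^\lambda)$ is computed from the norm of $\lambda_l\mathbf{w}_l$ and the Hessian with respect to the $l$-th layer's parameters evaluated at $\mathbf{w}^\lambda$. *)

theory Defs
  imports "HOL-Analysis.Derivative" "Jordan_Normal_Form.Char_Poly"
begin

no_notation inner (infix \<open>\<bullet>\<close> 70)

definition enorm :: "real vec \<Rightarrow> real" where
  "enorm v = sqrt (v \<bullet> v)"

(* Differential calculus on carrier_vec d. The dimension d is a term, so the type class based
   notions of HOL-Analysis only apply along lines, as in partial_deriv. *)

(* Frechet differentiability at x; the derivative is h \<mapsto> g \<bullet> h. *)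
definition differentiable_vec :: "nat \<Rightarrow> (real vec \<Rightarrow> real) \<Rightarrow> real vec \<Rightarrow> bool" where
  "differentiable_vec d F x \<longleftrightarrow>
     (\<exists>g \<in> carrier_vec d. \<forall>\<epsilon>>0. \<exists>\<delta>>0. \<forall>h \<in> carrier_vec d.
        enorm h < \<delta> \<longrightarrow> \<bar>F (x + h) - F x - g \<bullet> h\<bar> \<le> \<epsilon> * enorm h)"

definition partial_deriv :: "nat \<Rightarrow> nat \<Rightarrow> (real vec \<Rightarrow> real) \<Rightarrow> real vec \<Rightarrow> real" where
  "partial_deriv d i F x = deriv (\<lambda>t. F (x + t \<cdot>\<^sub>v unit_vec d i)) 0"

(* F is differentiable everywhere and so is its gradient (componentwise). *)
definition twice_differentiable_vec :: "nat \<Rightarrow> (real vec \<Rightarrow> real) \<Rightarrow> bool" where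
  "twice_differentiable_vec d F \<longleftrightarrow>
     (\<forall>x \<in> carrier_vec d. differentiable_vec d F x \<and>
        (\<forall>i<d. differentiable_vec d (partial_deriv d i F) x))"

definition hessian :: "nat \<Rightarrow> (real vec \<Rightarrow> real) \<Rightarrow> real vec \<Rightarrow> real mat" where
  "hessian d F x = mat d d (\<lambda>(i, j). partial_deriv d i (partial_deriv d j F) x)"

(* Only meaningful if A has a real eigenvalue, e.g. for symmetric A of positive dimension. *)
definition max_eigenvalue :: "real mat \<Rightarrow> real" where
  "max_eigenvalue A = Max {k. eigenvalue A k}"

(* Row-major vectorization of an nr x nc matrix, and its inverse. *)
definition vectorize :: "real mat \<Rightarrow> real vec" where
  "vectorize A = vec (dim_row A * dim_col A) (\<lambda>k. A $$ (k div dim_col A, k mod dim_col A))"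

definition unvectorize :: "nat \<Rightarrow> nat \<Rightarrow> real vec \<Rightarrow> real mat" where
  "unvectorize nr nc v = mat nr nc (\<lambda>(i, j). v $ (i * nc + j))"

lemma unvectorize_vectorize:
  assumes "A \<in> carrier_mat nr nc"
  shows "unvectorize nr nc (vectorize A) = A"
proof (rule eq_matI)
  fix i j assume ij: "i < dim_row A" "j < dim_col A"
  have "i * dim_col A + j < Suc i * dim_col A" using ij by simp
  also have "\<dots> \<le> dim_row A * dim_col A" using ij by (intro mult_le_mono1) simp
  finally show "unvectorize nr nc (vectorize A) $$ (i, j) = A $$ (i, j)"
    using assms ij by (simp add: unvectorize_def vectorize_def)
qed (use assms in \<open>simp_all add: unvectorize_def\<close>)

(* Layers are numbered 1..L and n l is the width of layer l, with n 0 the input dimension.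
   The values of w and b outside {1..L} play no role. *)

definition weights :: "nat \<Rightarrow> (nat \<Rightarrow> nat) \<Rightarrow> (nat \<Rightarrow> real mat) \<Rightarrow> bool" where
  "weights L n w \<longleftrightarrow> (\<forall>l \<in> {1..L}. w l \<in> carrier_mat (n l) (n (l - 1)))"

(* No activation is applied to the input or to the output of the last layer. *)
fun network :: "(real \<Rightarrow> real) \<Rightarrow> (nat \<Rightarrow> real vec) \<Rightarrow> nat \<Rightarrow> (nat \<Rightarrow> real mat) \<Rightarrow> real vec \<Rightarrow> real vec"
where
  "network \<sigma> b 0 w x = x"
| "network \<sigma> b (Suc 0) w x = w 1 *\<^sub>v x + b 1"
| "network \<sigma> b (Suc (Suc l)) w x =
     w (Suc (Suc l)) *\<^sub>v map_vec \<sigma> (network \<sigma> b (Suc l) w x) + b (Suc (Suc l))"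

definition emp_error ::
  "(real \<Rightarrow> real) \<Rightarrow> (nat \<Rightarrow> real vec) \<Rightarrow> nat \<Rightarrow> (real vec \<Rightarrow> real vec \<Rightarrow> real) \<Rightarrow>
   (real vec \<times> real vec) set \<Rightarrow> (nat \<Rightarrow> real mat) \<Rightarrow> real" where
  "emp_error \<sigma> b L loss S w = 1 / real (card S) * (\<Sum>(x, y)\<in>S. loss (network \<sigma> b L w x) y)"

(* An error function E on all weights, as a function of the vectorized l-th weight matrix,
   the other layers being held fixed at w. *)
definition layer_error ::
  "(nat \<Rightarrow> nat) \<Rightarrow> ((nat \<Rightarrow> real mat) \<Rightarrow> real) \<Rightarrow> nat \<Rightarrow> (nat \<Rightarrow> real mat) \<Rightarrow> real vec \<Rightarrow> real" where
  "layer_error n E l w v = E (w(l := unvectorize (n l) (n (l - 1)) v))"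

definition flatness ::
  "(nat \<Rightarrow> nat) \<Rightarrow> ((nat \<Rightarrow> real mat) \<Rightarrow> real) \<Rightarrow> nat \<Rightarrow> (nat \<Rightarrow> real mat) \<Rightarrow> real" where
  "flatness n E l w =
     (enorm (vectorize (w l)))\<^sup>2 *
     max_eigenvalue (hessian (n l * n (l - 1)) (layer_error n E l w) (vectorize (w l)))"

end

theory Submission
  imports Defs "Jordan_Normal_Form.Spectral_Radius"
begin

text \<open>Rescaling leaves the error unchanged, so as functions of the \<open>l\<close>-th layer the two errors are
  related by \<open>F v = G (c v)\<close>. By the chain rule the Hessian of \<open>F\<close> at \<open>v\<close> is \<open>c\<^sup>2\<close> times that of \<open>G\<close>
  at \<open>c v\<close>, and so is its largest eigenvalue; this cancels the factor \<open>c\<^sup>2\<close> between the squared norms.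
  The largest eigenvalue scales only if it exists, which needs a symmetric Hessian, i.e. Schwarz's
  theorem for functions that are merely twice differentiable (Peano's second difference argument).\<close>

section \<open>Eigenvalues of real symmetric matrices\<close>

text \<open>Evaluate the Hermitian form of \<open>?B\<close> at an eigenvector \<open>v\<close> in
  two ways: symmetry moves \<open>?B\<close> to the second argument, where it commutes with
  conjugation because its entries are real. This gives
  \<open>k * (v \<bullet>c v) = cnj k * (v \<bullet>c v)\<close> with \<open>v\<close>
  nonzero.\<close>

lemma eigenvalue_of_real_symmetric_real:
  fixes A :: "real mat" and k :: complex
  assumes A: "A \<in> carrier_mat n n" and sym: "transpose_mat A = A"
    and ev: "eigenvalue (map_mat complex_of_real A) k"
  shows "cnj k = k"
proof -
  let ?B = "map_mat complex_of_real A"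
  have B: "?B \<in> carrier_mat n n" using A by simp
  have symB: "transpose_mat ?B = ?B"
    using sym by (metis map_mat_transpose)
  obtain v where v: "v \<in> carrier_vec n" and v0: "v \<noteq> 0\<^sub>v n" and Bv: "?B *\<^sub>v v = k \<cdot>\<^sub>v v"
    using ev A unfolding eigenvalue_def eigenvector_def by auto
  have cv: "conjugate v \<in> carrier_vec n" using v by simp
  have conj: "conjugate (?B *\<^sub>v v) = ?B *\<^sub>v conjugate v"
    using A v by (intro eq_vecI) (auto simp: scalar_prod_def sum_conjugate conjugate_dist_mul conjugate_complex_def)
  have "k * (v \<bullet>c v) = (?B *\<^sub>v v) \<bullet>c v"
    using v cv by (simp add: Bv)
  also have "\<dots> = v \<bullet> (?B *\<^sub>v conjugate v)"
    using transpose_vec_mult_scalar[OF B cv v] symB by simp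
  also have "\<dots> = v \<bullet> (conjugate k \<cdot>\<^sub>v conjugate v)"
    by (simp add: conj[symmetric] Bv conjugate_smult_vec)
  also have "\<dots> = cnj k * (v \<bullet>c v)"
    using v cv by (simp add: conjugate_complex_def)
  finally show ?thesis
    using v v0 by simp
qed

text \<open>Over the complex numbers the spectrum is nonempty, and symmetry forces its elements to
  be real. This makes the set under \<open>Max\<close> in \<open>max_eigenvalue\<close>
  nonempty.\<close>

lemma symmetric_real_mat_has_eigenvalue:
  fixes A :: "real mat"
  assumes A: "A \<in> carrier_mat n n" and sym: "transpose_mat A = A" and n: "n > 0"
  shows "\<exists>k. eigenvalue A k"
proof -
  let ?B = "map_mat complex_of_real A"
  have B: "?B \<in> carrier_mat n n" using A by simp
  obtain z where z: "eigenvalue ?B z"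
    using spectrum_non_empty[OF B n] unfolding spectrum_def by auto
  define r where "r = Re z"
  have "z = complex_of_real r"
    using eigenvalue_of_real_symmetric_real[OF A sym z] by (simp add: r_def complex_eq_iff)
  \<comment> \<open>The characteristic polynomial of the complexified matrix is the image of the
    real one, so a root that is real descends.\<close>
  then have "poly (map_poly complex_of_real (char_poly A)) (complex_of_real r) = 0"
    using z eigenvalue_root_char_poly[OF B] of_real_hom.char_poly_hom[OF A] by metis
  then have "poly (char_poly A) r = 0" by simp
  then show ?thesis
    using eigenvalue_root_char_poly[OF A] by blast
qed

lemma eigenvalue_smult_mat:
  fixes A :: "real mat"
  assumes A: "A \<in> carrier_mat n n" and ev: "eigenvalue A k"
  shows "eigenvalue (a \<cdot>\<^sub>m A) (a * k)"
proof -
  obtain v where v: "v \<in> carrier_vec n" "v \<noteq> 0\<^sub>v n" and Av: "A *\<^sub>v v = k \<cdot>\<^sub>v v"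
    using ev A unfolding eigenvalue_def eigenvector_def by auto
  have "(a \<cdot>\<^sub>m A) *\<^sub>v v = a \<cdot>\<^sub>v (A *\<^sub>v v)"
    using A v by (intro eq_vecI) (auto simp: scalar_prod_def sum_distrib_left mult.assoc)
  then have "(a \<cdot>\<^sub>m A) *\<^sub>v v = (a * k) \<cdot>\<^sub>v v"
    by (simp add: Av smult_smult_assoc)
  then show ?thesis
    using v A unfolding eigenvalue_def eigenvector_def by auto
qed

text \<open>Multiplication by \<open>a > 0\<close> maps the spectrum of \<open>A\<close> onto that
  of the multiple and is monotone, so it commutes with \<open>Max\<close> on a finite nonempty
  set.\<close>

lemma max_eigenvalue_smult_mat:
  fixes A :: "real mat"
  assumes A: "A \<in> carrier_mat n n" and sym: "transpose_mat A = A" and n: "n > 0" and a: "a > 0"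
  shows "max_eigenvalue (a \<cdot>\<^sub>m A) = a * max_eigenvalue A"
proof -
  \<comment> \<open>The reverse inclusion is the forward one for the factor
    \<open>inverse a\<close>.\<close>
  have "eigenvalue A (k / a)" if "eigenvalue (a \<cdot>\<^sub>m A) k" for k
  proof -
    have "inverse a \<cdot>\<^sub>m (a \<cdot>\<^sub>m A) = A"
      using a by (intro eq_matI) auto
    then show ?thesis
      using eigenvalue_smult_mat[OF _ that, of n "inverse a"] A by (simp add: divide_inverse mult.commute)
  qed
  then have "{k. eigenvalue (a \<cdot>\<^sub>m A) k} = (*) a ` {k. eigenvalue A k}"
    using eigenvalue_smult_mat[OF A] a by (force simp: image_iff)
  moreover have "finite {k. eigenvalue A k}"
    using card_finite_spectrum(1)[OF A] by (simp add: spectrum_def)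
  moreover have "{k. eigenvalue A k} \<noteq> {}"
    using symmetric_real_mat_has_eigenvalue[OF A sym n] by simp
  moreover have "mono ((*) a)"
    using a by (intro monoI mult_left_mono) auto
  ultimately show ?thesis
    unfolding max_eigenvalue_def by (simp add: mono_Max_commute)
qed

section \<open>Differential calculus on carrier\_vec\<close>

lemma enorm_smult: "enorm (a \<cdot>\<^sub>v v) = \<bar>a\<bar> * enorm v"
proof -
  have "(a \<cdot>\<^sub>v v) \<bullet> (a \<cdot>\<^sub>v v) = a\<^sup>2 * (v \<bullet> v)"
    by (simp add: power2_eq_square)
  then show ?thesis
    by (simp add: enorm_def real_sqrt_mult)
qed

lemma enorm_nonneg: "enorm v \<ge> 0"
  unfolding enorm_def by (simp add: scalar_prod_def sum_nonneg)

text \<open>Triangle inequality for the increments of the second difference. The cross term survives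
  only for \<open>i = j\<close>, a case that occurs on the diagonal of the Hessian.\<close>

lemma enorm_unit_vec_comb:
  assumes "i < d" "j < d"
  shows "enorm (s \<cdot>\<^sub>v unit_vec d i + t \<cdot>\<^sub>v unit_vec d j) \<le> \<bar>s\<bar> + \<bar>t\<bar>"
proof -
  let ?e = "unit_vec d :: nat \<Rightarrow> real vec"
  have "(s \<cdot>\<^sub>v ?e i + t \<cdot>\<^sub>v ?e j) \<bullet> (s \<cdot>\<^sub>v ?e i + t \<cdot>\<^sub>v ?e j) =
      s\<^sup>2 + t\<^sup>2 + 2 * (s * t) * (if i = j then 1 else 0)"
    using assms
    by (simp add: scalar_prod_add_distrib[of _ d] power2_eq_square algebra_simps)
  also have "\<dots> \<le> s\<^sup>2 + t\<^sup>2 + 2 * (\<bar>s\<bar> * \<bar>t\<bar>)"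
    using abs_ge_self[of "s * t"] by (simp add: abs_mult)
  also have "\<dots> = (\<bar>s\<bar> + \<bar>t\<bar>)\<^sup>2"
    by (simp add: power2_eq_square algebra_simps)
  finally show ?thesis
    unfolding enorm_def by (simp add: real_le_lsqrt)
qed

text \<open>Restricting the Frechet estimate to a line links \<open>differentiable_vec\<close> to
  one-variable calculus. The gradient \<open>g\<close> is explicit so that its entries can be
  identified afterwards.\<close>

lemma differentiable_vec_has_real_derivative:
  assumes g: "\<And>\<epsilon>. \<epsilon> > 0 \<Longrightarrow> \<exists>\<delta>>0. \<forall>h \<in> carrier_vec d.
        enorm h < \<delta> \<longrightarrow> \<bar>F (x + h) - F x - g \<bullet> h\<bar> \<le> \<epsilon> * enorm h"
    and gd: "g \<in> carrier_vec d" and x: "x \<in> carrier_vec d" and u: "u \<in> carrier_vec d"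
  shows "((\<lambda>t. F (x + t \<cdot>\<^sub>v u)) has_real_derivative g \<bullet> u) (at 0)"
  unfolding has_field_derivative_def has_derivative_at_alt
proof (intro conjI allI impI)
  show "bounded_linear ((*) (g \<bullet> u))" by (rule bounded_linear_mult_right)
  fix e :: real assume e: "e > 0"
  \<comment> \<open>The added 1 keeps the divisor positive even for \<open>u = 0\<close>.\<close>
  define N where "N = enorm u + 1"
  have N: "N > 0" "enorm u \<le> N" using enorm_nonneg[of u] by (auto simp: N_def)
  obtain \<delta> where \<delta>: "\<delta> > 0" "\<And>h. h \<in> carrier_vec d \<Longrightarrow> enorm h < \<delta> \<Longrightarrow>
      \<bar>F (x + h) - F x - g \<bullet> h\<bar> \<le> e / N * enorm h"
    using g[of "e / N"] e N by auto
  show "\<exists>r>0. \<forall>y. norm (y - 0) < r \<longrightarrow>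
      norm (F (x + y \<cdot>\<^sub>v u) - F (x + 0 \<cdot>\<^sub>v u) - g \<bullet> u * (y - 0)) \<le> e * norm (y - 0)"
  proof (intro exI[of _ "\<delta> / N"] conjI allI impI)
    show "\<delta> / N > 0" using \<delta> N by simp
    fix y :: real assume "norm (y - 0) < \<delta> / N"
    then have y: "\<bar>y\<bar> * N < \<delta>" using N by (simp add: field_simps)
    have le: "\<bar>y\<bar> * enorm u \<le> \<bar>y\<bar> * N" using N by (intro mult_left_mono) auto
    have "\<bar>F (x + y \<cdot>\<^sub>v u) - F x - g \<bullet> (y \<cdot>\<^sub>v u)\<bar> \<le> e / N * (\<bar>y\<bar> * enorm u)"
      using \<delta>(2)[of "y \<cdot>\<^sub>v u"] u le y by (simp add: enorm_smult)
    also have "\<dots> \<le> e / N * (\<bar>y\<bar> * N)"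
      using le e N by (intro mult_left_mono) auto
    finally have "\<bar>F (x + y \<cdot>\<^sub>v u) - F x - g \<bullet> (y \<cdot>\<^sub>v u)\<bar> \<le> e / N * (\<bar>y\<bar> * N)" .
    moreover have "x + 0 \<cdot>\<^sub>v u = x"
      using x u by (intro eq_vecI) auto
    ultimately show "norm (F (x + y \<cdot>\<^sub>v u) - F (x + 0 \<cdot>\<^sub>v u) - g \<bullet> u * (y - 0)) \<le> e * norm (y - 0)"
      using gd x u N by (simp add: mult.commute)
  qed
qed

text \<open>Derivatives along the unit vectors determine the existential witness in
  \<open>differentiable_vec\<close>, so it can be replaced by the vector of partial
  derivatives.\<close>

lemma differentiable_vec_gradient:
  assumes diff: "differentiable_vec d F x" and x: "x \<in> carrier_vec d"
  defines "g \<equiv> vec d (\<lambda>i. partial_deriv d i F x)"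
  shows "\<epsilon> > 0 \<Longrightarrow> \<exists>\<delta>>0. \<forall>h \<in> carrier_vec d.
      enorm h < \<delta> \<longrightarrow> \<bar>F (x + h) - F x - g \<bullet> h\<bar> \<le> \<epsilon> * enorm h"
proof -
  obtain g' where g'd: "g' \<in> carrier_vec d" and g': "\<And>\<epsilon>. \<epsilon> > 0 \<Longrightarrow> \<exists>\<delta>>0. \<forall>h \<in> carrier_vec d.
        enorm h < \<delta> \<longrightarrow> \<bar>F (x + h) - F x - g' \<bullet> h\<bar> \<le> \<epsilon> * enorm h"
    using diff unfolding differentiable_vec_def by blast
  have "partial_deriv d i F x = g' $ i" if "i < d" for i
    using differentiable_vec_has_real_derivative[OF g' g'd x, of "unit_vec d i"] that g'd
    unfolding partial_deriv_def by (simp add: DERIV_imp_deriv)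
  then have "g = g'"
    using g'd by (intro eq_vecI) (auto simp: g_def)
  then show "\<epsilon> > 0 \<Longrightarrow> \<exists>\<delta>>0. \<forall>h \<in> carrier_vec d.
      enorm h < \<delta> \<longrightarrow> \<bar>F (x + h) - F x - g \<bullet> h\<bar> \<le> \<epsilon> * enorm h"
    using g' by blast
qed

text \<open>\<open>partial_deriv\<close> differentiates at parameter 0 from a moving base point; a
  shift turns this into the derivative at any \<open>s\<close> along a fixed line, the form that the
  mean value theorem needs.\<close>

lemma has_real_derivative_partial_deriv:
  assumes diff: "differentiable_vec d F (x + s \<cdot>\<^sub>v unit_vec d i)"
    and x: "x \<in> carrier_vec d" and i: "i < d"
  shows "((\<lambda>t. F (x + t \<cdot>\<^sub>v unit_vec d i)) has_real_derivative
          partial_deriv d i F (x + s \<cdot>\<^sub>v unit_vec d i)) (at s)"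
proof -
  let ?y = "x + s \<cdot>\<^sub>v unit_vec d i"
  have y: "?y \<in> carrier_vec d" using x by simp
  have "((\<lambda>t. F (?y + t \<cdot>\<^sub>v unit_vec d i)) has_real_derivative partial_deriv d i F ?y) (at 0)"
    using differentiable_vec_has_real_derivative[OF differentiable_vec_gradient[OF diff y] _ y,
        of "unit_vec d i"] i by simp
  moreover have "?y + t \<cdot>\<^sub>v unit_vec d i = x + (t + s) \<cdot>\<^sub>v unit_vec d i" for t
    using x by (intro eq_vecI) (auto simp: algebra_simps)
  ultimately show ?thesis
    using DERIV_shift[of "\<lambda>t. F (x + t \<cdot>\<^sub>v unit_vec d i)" _ 0 s] by simp
qed

text \<open>The mean value theorem along \<open>e i\<close> turns the second difference into
  \<open>t\<close> times a difference of two values of \<open>partial_deriv d i F\<close>.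
  Differentiability of that function at \<open>x\<close> evaluates both values to first order, so
  continuity of second derivatives is never invoked.\<close>

lemma second_difference_approx:
  fixes F :: "real vec \<Rightarrow> real" and d :: nat
  defines "e \<equiv> (unit_vec d :: nat \<Rightarrow> real vec)"
  assumes diff: "\<And>y. y \<in> carrier_vec d \<Longrightarrow> differentiable_vec d F y"
    and diff2: "differentiable_vec d (partial_deriv d i F) x"
    and x: "x \<in> carrier_vec d" and i: "i < d" and j: "j < d" and \<epsilon>: "\<epsilon> > 0"
  shows "\<exists>\<delta>>0. \<forall>t. 0 < t \<longrightarrow> t < \<delta> \<longrightarrow>
    \<bar>F (x + t \<cdot>\<^sub>v e i + t \<cdot>\<^sub>v e j) - F (x + t \<cdot>\<^sub>v e i) - F (x + t \<cdot>\<^sub>v e j) + F x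
      - t\<^sup>2 * partial_deriv d j (partial_deriv d i F) x\<bar> \<le> 3 * \<epsilon> * t\<^sup>2"
proof -
  define P where "P = partial_deriv d i F"
  define g where "g = vec d (\<lambda>k. partial_deriv d k P x)"
  have e: "e k \<in> carrier_vec d" for k by (simp add: e_def)
  have gd: "g \<in> carrier_vec d" by (simp add: g_def)
  obtain \<delta> where \<delta>: "\<delta> > 0" "\<And>h. h \<in> carrier_vec d \<Longrightarrow> enorm h < \<delta> \<Longrightarrow>
      \<bar>P (x + h) - P x - g \<bullet> h\<bar> \<le> \<epsilon> * enorm h"
    using differentiable_vec_gradient[OF diff2 x \<epsilon>] unfolding P_def g_def by blast
  have approx: "\<bar>P (x + (s \<cdot>\<^sub>v e i + r \<cdot>\<^sub>v e j)) - P x - (s * g $ i + r * g $ j)\<bar> \<le> \<epsilon> * (\<bar>s\<bar> + \<bar>r\<bar>)"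
    if "\<bar>s\<bar> + \<bar>r\<bar> < \<delta>" for s r
  proof -
    let ?h = "s \<cdot>\<^sub>v e i + r \<cdot>\<^sub>v e j"
    have n: "enorm ?h \<le> \<bar>s\<bar> + \<bar>r\<bar>"
      unfolding e_def by (rule enorm_unit_vec_comb[OF i j])
    have "g \<bullet> ?h = s * g $ i + r * g $ j"
      using gd i j by (simp add: e_def scalar_prod_add_distrib[of _ d])
    then have "\<bar>P (x + ?h) - P x - (s * g $ i + r * g $ j)\<bar> \<le> \<epsilon> * enorm ?h"
      using \<delta>(2)[of ?h] e n that by simp
    also have "\<dots> \<le> \<epsilon> * (\<bar>s\<bar> + \<bar>r\<bar>)"
      using n \<epsilon> by (intro mult_left_mono) auto
    finally show ?thesis .
  qed
  \<comment> \<open>With \<open>t\<close> below \<open>\<delta> / 2\<close> and the intermediate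
    point \<open>z < t\<close>, the sum \<open>z + t\<close> stays below \<open>\<delta>\<close>, as
    \<open>approx\<close> demands.\<close>
  have "\<bar>F (x + t \<cdot>\<^sub>v e i + t \<cdot>\<^sub>v e j) - F (x + t \<cdot>\<^sub>v e i) - F (x + t \<cdot>\<^sub>v e j) + F x
      - t\<^sup>2 * g $ j\<bar> \<le> 3 * \<epsilon> * t\<^sup>2" if t: "0 < t" "t < \<delta> / 2" for t
  proof -
    have D: "((\<lambda>s. F (y + s \<cdot>\<^sub>v e i)) has_real_derivative P (y + s \<cdot>\<^sub>v e i)) (at s)"
      if "y \<in> carrier_vec d" for y s
      using has_real_derivative_partial_deriv[OF diff that i] that by (simp add: P_def e_def)
    \<comment> \<open>The increment of \<open>F\<close> in direction \<open>e j\<close>, as a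
      function of the displacement along \<open>e i\<close>; the second difference is
      \<open>f t - f 0\<close>.\<close>
    define f where "f s = F (x + t \<cdot>\<^sub>v e j + s \<cdot>\<^sub>v e i) - F (x + s \<cdot>\<^sub>v e i)" for s
    have "(f has_real_derivative P (x + t \<cdot>\<^sub>v e j + s \<cdot>\<^sub>v e i) - P (x + s \<cdot>\<^sub>v e i)) (at s)" for s
      unfolding f_def using x e by (intro DERIV_diff D) auto
    from MVT2[OF t(1) this] obtain z where z: "0 < z" "z < t"
      and fz: "f t - f 0 = (t - 0) * (P (x + t \<cdot>\<^sub>v e j + z \<cdot>\<^sub>v e i) - P (x + z \<cdot>\<^sub>v e i))"
      by blast
    \<comment> \<open>Both points are brought to the form that \<open>approx\<close> expects, the
      second with coefficient 0 on \<open>e j\<close>.\<close>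
    have comm: "x + t \<cdot>\<^sub>v e j + s \<cdot>\<^sub>v e i = x + (s \<cdot>\<^sub>v e i + t \<cdot>\<^sub>v e j)"
      "x + s \<cdot>\<^sub>v e i = x + (s \<cdot>\<^sub>v e i + 0 \<cdot>\<^sub>v e j)"
      "x + s \<cdot>\<^sub>v e i + t \<cdot>\<^sub>v e j = x + (s \<cdot>\<^sub>v e i + t \<cdot>\<^sub>v e j)" for s
      using x by (auto simp: e_def intro!: eq_vecI)
    define A where "A = P (x + (z \<cdot>\<^sub>v e i + t \<cdot>\<^sub>v e j))"
    define B where "B = P (x + (z \<cdot>\<^sub>v e i + 0 \<cdot>\<^sub>v e j))"
    have A: "\<bar>A - P x - (z * g $ i + t * g $ j)\<bar> \<le> \<epsilon> * (z + t)"
      using approx[of z t] z t by (simp add: A_def)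
    have B: "\<bar>B - P x - z * g $ i\<bar> \<le> \<epsilon> * z"
      using approx[of z 0] z t by (simp add: B_def)
    \<comment> \<open>The terms \<open>z * g $ i\<close> cancel, and the error is at most 3
      \<open>\<epsilon> * t\<close> because \<open>z < t\<close>.\<close>
    have "\<bar>(A - B) - t * g $ j\<bar> \<le> \<epsilon> * (z + t) + \<epsilon> * z"
      using A B by linarith
    also have "\<dots> \<le> 3 * \<epsilon> * t"
    proof -
      have "\<epsilon> * z \<le> \<epsilon> * t" using z \<epsilon> by simp
      then show ?thesis by (simp add: algebra_simps)
    qed
    finally have AB: "\<bar>(A - B) - t * g $ j\<bar> \<le> 3 * \<epsilon> * t" .
    have "F (x + t \<cdot>\<^sub>v e i + t \<cdot>\<^sub>v e j) - F (x + t \<cdot>\<^sub>v e i) - F (x + t \<cdot>\<^sub>v e j) + F x = f t - f 0"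
    proof -
      have "x + t \<cdot>\<^sub>v e j + 0 \<cdot>\<^sub>v e i = x + t \<cdot>\<^sub>v e j" "x + 0 \<cdot>\<^sub>v e i = x"
        using x by (auto simp: e_def intro!: eq_vecI)
      then show ?thesis unfolding f_def by (simp add: comm(1,3))
    qed
    also have "f t - f 0 = t * (A - B)"
      using fz comm(1)[of z] comm(2)[of z] by (simp add: A_def B_def)
    finally have "\<bar>F (x + t \<cdot>\<^sub>v e i + t \<cdot>\<^sub>v e j) - F (x + t \<cdot>\<^sub>v e i) - F (x + t \<cdot>\<^sub>v e j) + F x
      - t\<^sup>2 * g $ j\<bar> = \<bar>t * ((A - B) - t * g $ j)\<bar>"
      by (simp add: power2_eq_square algebra_simps)
    also have "\<dots> = t * \<bar>(A - B) - t * g $ j\<bar>"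
      using t by (simp add: abs_mult)
    also have "\<dots> \<le> t * (3 * \<epsilon> * t)"
      using AB t by (intro mult_left_mono) auto
    finally show ?thesis
      by (simp add: power2_eq_square algebra_simps)
  qed
  moreover have "g $ j = partial_deriv d j (partial_deriv d i F) x"
    using j by (simp add: g_def P_def)
  ultimately show ?thesis
    using \<delta>(1) by (intro exI[of _ "\<delta> / 2"]) auto
qed

text \<open>The second difference is symmetric in \<open>i\<close> and \<open>j\<close>, and divided
  by \<open>t\<^sup>2\<close> it tends to either mixed derivative, so the two coincide.\<close>

lemma partial_deriv_commute:
  assumes F: "twice_differentiable_vec d F" and x: "x \<in> carrier_vec d" and i: "i < d" and j: "j < d"
  shows "partial_deriv d i (partial_deriv d j F) x = partial_deriv d j (partial_deriv d i F) x"
proof -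
  let ?a = "partial_deriv d j (partial_deriv d i F) x"
  let ?b = "partial_deriv d i (partial_deriv d j F) x"
  let ?e = "unit_vec d :: nat \<Rightarrow> real vec"
  have diff: "\<And>y. y \<in> carrier_vec d \<Longrightarrow> differentiable_vec d F y"
    and diffi: "differentiable_vec d (partial_deriv d i F) x"
    and diffj: "differentiable_vec d (partial_deriv d j F) x"
    using F x i j unfolding twice_differentiable_vec_def by auto
  have "\<bar>?a - ?b\<bar> \<le> \<epsilon>" if \<epsilon>: "\<epsilon> > 0" for \<epsilon>
  proof -
    \<comment> \<open>Each approximation contributes \<open>3 * (\<epsilon> / 6)\<close>, that is
      \<open>\<epsilon> / 2\<close>, per unit of \<open>t\<^sup>2\<close>.\<close>
    have \<epsilon>6: "\<epsilon> / 6 > 0" using \<epsilon> by simp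
    obtain \<delta>1 where \<delta>1: "\<delta>1 > 0" "\<And>t. 0 < t \<Longrightarrow> t < \<delta>1 \<Longrightarrow>
        \<bar>F (x + t \<cdot>\<^sub>v ?e i + t \<cdot>\<^sub>v ?e j) - F (x + t \<cdot>\<^sub>v ?e i) - F (x + t \<cdot>\<^sub>v ?e j) + F x - t\<^sup>2 * ?a\<bar>
          \<le> 3 * (\<epsilon> / 6) * t\<^sup>2"
      using second_difference_approx[OF diff diffi x i j \<epsilon>6] by blast
    obtain \<delta>2 where \<delta>2: "\<delta>2 > 0" "\<And>t. 0 < t \<Longrightarrow> t < \<delta>2 \<Longrightarrow>
        \<bar>F (x + t \<cdot>\<^sub>v ?e j + t \<cdot>\<^sub>v ?e i) - F (x + t \<cdot>\<^sub>v ?e j) - F (x + t \<cdot>\<^sub>v ?e i) + F x - t\<^sup>2 * ?b\<bar>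
          \<le> 3 * (\<epsilon> / 6) * t\<^sup>2"
      using second_difference_approx[OF diff diffj x j i \<epsilon>6] by blast
    define t where "t = min \<delta>1 \<delta>2 / 2"
    have t: "0 < t" "t < \<delta>1" "t < \<delta>2" using \<delta>1(1) \<delta>2(1) unfolding t_def by linarith+
    have swap: "x + t \<cdot>\<^sub>v ?e j + t \<cdot>\<^sub>v ?e i = x + t \<cdot>\<^sub>v ?e i + t \<cdot>\<^sub>v ?e j"
      using x by (intro eq_vecI) auto
    \<comment> \<open>The two estimates list the middle terms in opposite order; stating the
      comparison for plain reals leaves a linear problem.\<close>
    have close: "\<bar>a - b\<bar> \<le> r + r"
      if "\<bar>p - y - z + w - a\<bar> \<le> r" "\<bar>p - z - y + w - b\<bar> \<le> r"
      for a b p r y z w :: real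
      using that by linarith
    note \<delta>2t = \<delta>2(2)[OF t(1,3), unfolded swap]
    have "\<bar>t\<^sup>2 * ?a - t\<^sup>2 * ?b\<bar> \<le> t\<^sup>2 * \<epsilon>"
      using close[OF \<delta>1(2)[OF t(1,2)] \<delta>2t] by (simp add: mult.commute)
    moreover have "\<bar>t\<^sup>2 * ?a - t\<^sup>2 * ?b\<bar> = t\<^sup>2 * \<bar>?a - ?b\<bar>"
      unfolding right_diff_distrib[symmetric] by (simp add: abs_mult)
    ultimately have "t\<^sup>2 * \<bar>?a - ?b\<bar> \<le> t\<^sup>2 * \<epsilon>" by (simp only:)
    then show ?thesis using t by simp
  qed
  then have "\<bar>?a - ?b\<bar> \<le> 0" by (rule field_le_epsilon) simp
  then show ?thesis by simp
qed

lemma transpose_hessian: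
  assumes "twice_differentiable_vec d F" and "x \<in> carrier_vec d"
  shows "transpose_mat (hessian d F x) = hessian d F x"
  using partial_deriv_commute[OF assms] by (intro eq_matI) (auto simp: hessian_def)

text \<open>Chain rule for the dilation by \<open>c\<close>. The extra factor \<open>a\<close> lets
  the rule be applied again to its own conclusion.\<close>

lemma partial_deriv_smult:
  assumes diff: "\<And>y. y \<in> carrier_vec d \<Longrightarrow> differentiable_vec d G y"
    and FG: "\<And>v. v \<in> carrier_vec d \<Longrightarrow> F v = a * G (c \<cdot>\<^sub>v v)"
    and x: "x \<in> carrier_vec d" and i: "i < d"
  shows "partial_deriv d i F x = a * c * partial_deriv d i G (c \<cdot>\<^sub>v x)"
proof -
  let ?e = "unit_vec d i :: real vec" and ?D = "partial_deriv d i G (c \<cdot>\<^sub>v x)"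
  have cx: "c \<cdot>\<^sub>v x \<in> carrier_vec d" using x by simp
  have cx0: "c \<cdot>\<^sub>v x + 0 \<cdot>\<^sub>v ?e = c \<cdot>\<^sub>v x"
    using x by (intro eq_vecI) auto
  have "((\<lambda>s. G (c \<cdot>\<^sub>v x + s \<cdot>\<^sub>v ?e)) has_real_derivative ?D) (at (c * 0))"
    using has_real_derivative_partial_deriv[OF _ cx i, where F = G and s = 0] diff cx cx0 by simp
  moreover have "((\<lambda>t. c * t) has_real_derivative c) (at 0)"
    by (auto intro!: derivative_eq_intros)
  ultimately have "((\<lambda>t. G (c \<cdot>\<^sub>v x + (c * t) \<cdot>\<^sub>v ?e)) has_real_derivative ?D * c) (at 0)"
    by (rule DERIV_chain2)
  then have "((\<lambda>t. a * G (c \<cdot>\<^sub>v x + (c * t) \<cdot>\<^sub>v ?e)) has_real_derivative a * (?D * c)) (at 0)"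
    by (rule DERIV_cmult)
  moreover have "a * G (c \<cdot>\<^sub>v x + (c * t) \<cdot>\<^sub>v ?e) = F (x + t \<cdot>\<^sub>v ?e)" for t
    using x by (simp add: FG smult_add_distrib_vec[of _ d] smult_smult_assoc)
  ultimately have "((\<lambda>t. F (x + t \<cdot>\<^sub>v ?e)) has_real_derivative a * (?D * c)) (at 0)"
    by simp
  then show ?thesis
    unfolding partial_deriv_def[of d i F] by (simp add: DERIV_imp_deriv)
qed

text \<open>Two rounds of the chain rule, with factor 1 and then with factor \<open>c\<close>. The
  first round must hold at every \<open>v\<close>, since its result is differentiated again.\<close>

lemma hessian_smult:
  assumes G: "twice_differentiable_vec d G"
    and FG: "\<And>v. v \<in> carrier_vec d \<Longrightarrow> F v = G (c \<cdot>\<^sub>v v)"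
    and x: "x \<in> carrier_vec d"
  shows "hessian d F x = c\<^sup>2 \<cdot>\<^sub>m hessian d G (c \<cdot>\<^sub>v x)"
proof -
  have "partial_deriv d j F v = c * partial_deriv d j G (c \<cdot>\<^sub>v v)"
    if "v \<in> carrier_vec d" "j < d" for v j
    using partial_deriv_smult[of d G F 1 c v j] G FG that
    by (simp add: twice_differentiable_vec_def)
  then have "partial_deriv d i (partial_deriv d j F) x =
      c * c * partial_deriv d i (partial_deriv d j G) (c \<cdot>\<^sub>v x)" if "i < d" "j < d" for i j
    using partial_deriv_smult[of d "partial_deriv d j G" "partial_deriv d j F" c c x i] G x that
    by (simp add: twice_differentiable_vec_def)
  then show ?thesis
    by (intro eq_matI) (auto simp: hessian_def power2_eq_square)
qed

section \<open>Rescaling the layers\<close>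

lemma vectorize_carrier:
  "A \<in> carrier_mat nr nc \<Longrightarrow> vectorize A \<in> carrier_vec (nr * nc)"
  by (auto simp: vectorize_def)

lemma vectorize_smult: "vectorize (c \<cdot>\<^sub>m A) = c \<cdot>\<^sub>v vectorize A"
proof (rule eq_vecI)
  fix k assume "k < dim_vec (c \<cdot>\<^sub>v vectorize A)"
  then have k: "k < dim_row A * dim_col A" by (simp add: vectorize_def)
  then have "k div dim_col A < dim_row A" by (simp add: less_mult_imp_div_less)
  moreover have "k mod dim_col A < dim_col A"
    using k by (cases "dim_col A = 0") auto
  ultimately show "vectorize (c \<cdot>\<^sub>m A) $ k = (c \<cdot>\<^sub>v vectorize A) $ k"
    using k by (simp add: vectorize_def)
qed (simp add: vectorize_def)

lemma unvectorize_smult: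
  assumes "v \<in> carrier_vec (nr * nc)"
  shows "unvectorize nr nc (c \<cdot>\<^sub>v v) = c \<cdot>\<^sub>m unvectorize nr nc v"
proof (rule eq_matI)
  fix i j assume "i < dim_row (c \<cdot>\<^sub>m unvectorize nr nc v)" "j < dim_col (c \<cdot>\<^sub>m unvectorize nr nc v)"
  then have ij: "i < nr" "j < nc" by (auto simp: unvectorize_def)
  \<comment> \<open>The row-major index stays within \<open>v\<close>, where scaling acts
    entrywise.\<close>
  have "i * nc + j < Suc i * nc" using ij by simp
  also have "\<dots> \<le> nr * nc" using ij by (intro mult_le_mono1) simp
  finally show "unvectorize nr nc (c \<cdot>\<^sub>v v) $$ (i, j) = (c \<cdot>\<^sub>m unvectorize nr nc v) $$ (i, j)"
    using ij assms by (simp add: unvectorize_def)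
qed (auto simp: unvectorize_def)

lemma weights_smult: "weights L n u \<Longrightarrow> weights L n (\<lambda>k. c k \<cdot>\<^sub>m u k)"
  by (simp add: weights_def)

text \<open>The network structure enters only through invariance of \<open>E\<close>. Invariance is
  needed at all admissible weights because the Hessian probes perturbations of layer
  \<open>l\<close>; a positive number of entries ensures that an eigenvalue exists.\<close>

lemma flatness_smult:
  fixes E :: "(nat \<Rightarrow> real mat) \<Rightarrow> real"
  assumes inv: "\<And>u. weights L n u \<Longrightarrow> E (\<lambda>k. c k \<cdot>\<^sub>m u k) = E u"
    and diff: "twice_differentiable_vec (n l * n (l - 1)) (layer_error n E l (\<lambda>k. c k \<cdot>\<^sub>m w k))"
    and w: "weights L n w" and l: "l \<in> {1..L}" and d: "n l * n (l - 1) > 0" and c: "c l > 0"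
  shows "flatness n E l w = flatness n E l (\<lambda>k. c k \<cdot>\<^sub>m w k)"
proof -
  let ?wc = "\<lambda>k. c k \<cdot>\<^sub>m w k" and ?d = "n l * n (l - 1)" and ?v = "vectorize (w l)"
  let ?F = "layer_error n E l w"
  define G where "G = layer_error n E l ?wc"
  have G: "twice_differentiable_vec ?d G" using diff by (simp add: G_def)
  have v: "?v \<in> carrier_vec ?d"
    using w l by (intro vectorize_carrier) (auto simp: weights_def)
  have FG: "?F v = G (c l \<cdot>\<^sub>v v)" if v: "v \<in> carrier_vec ?d" for v
  proof -
    let ?A = "unvectorize (n l) (n (l - 1)) v"
    have "weights L n (w(l := ?A))"
      using w by (simp add: weights_def unvectorize_def)
    then have "E (w(l := ?A)) = E (\<lambda>k. c k \<cdot>\<^sub>m (w(l := ?A)) k)"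
      by (rule inv[symmetric])
    \<comment> \<open>Rescaling the perturbed weights multiplies the inserted matrix by
      \<open>c l\<close> and turns the fixed layers into those of \<open>?wc\<close>.\<close>
    also have "(\<lambda>k. c k \<cdot>\<^sub>m (w(l := ?A)) k) = ?wc(l := c l \<cdot>\<^sub>m ?A)"
      by auto
    finally show ?thesis
      unfolding layer_error_def G_def unvectorize_smult[OF v] .
  qed
  have "hessian ?d ?F ?v = (c l)\<^sup>2 \<cdot>\<^sub>m hessian ?d G (c l \<cdot>\<^sub>v ?v)"
    by (rule hessian_smult[OF G FG v])
  moreover have "hessian ?d G (c l \<cdot>\<^sub>v ?v) \<in> carrier_mat ?d ?d"
    by (simp add: hessian_def)
  moreover have "transpose_mat (hessian ?d G (c l \<cdot>\<^sub>v ?v)) = hessian ?d G (c l \<cdot>\<^sub>v ?v)"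
    using v by (intro transpose_hessian G) simp
  ultimately have "max_eigenvalue (hessian ?d ?F ?v) =
      (c l)\<^sup>2 * max_eigenvalue (hessian ?d G (c l \<cdot>\<^sub>v ?v))"
    using max_eigenvalue_smult_mat[of _ ?d] d c by simp
  then show ?thesis
    unfolding flatness_def G_def[symmetric]
    by (simp add: vectorize_smult enorm_smult power_mult_distrib)
qed

theorem theorem2:
  fixes L :: nat and n :: "nat \<Rightarrow> nat"
    and \<sigma> :: "real \<Rightarrow> real" and b :: "nat \<Rightarrow> real vec"
    and loss :: "real vec \<Rightarrow> real vec \<Rightarrow> real"
    and S :: "(real vec \<times> real vec) set"
    and c :: "nat \<Rightarrow> real"
    and w :: "nat \<Rightarrow> real mat"
  assumes "L \<ge> 1" and "\<forall>l \<in> {0..L}. n l > 0"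
    and "\<forall>l \<in> {1..L}. b l \<in> carrier_vec (n l)"
    and "\<forall>y \<in> carrier_vec (n L). \<forall>y' \<in> carrier_vec (n L). loss y y' \<ge> 0"
    and "finite S" and "S \<noteq> {}" and "S \<subseteq> carrier_vec (n 0) \<times> carrier_vec (n L)"
    and "\<forall>u. weights L n u \<longrightarrow> (\<forall>l \<in> {1..L}.
           twice_differentiable_vec (n l * n (l - 1))
             (layer_error n (emp_error \<sigma> b L loss S) l u))"
    and "\<forall>l \<in> {1..L}. c l > 0"
    and "\<forall>u. weights L n u \<longrightarrow> (\<forall>x \<in> carrier_vec (n 0).
           network \<sigma> b L u x = network \<sigma> b L (\<lambda>l. c l \<cdot>\<^sub>m u l) x)"
    and "weights L n w"
  shows "\<forall>l \<in> {1..L}.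
           flatness n (emp_error \<sigma> b L loss S) l w =
           flatness n (emp_error \<sigma> b L loss S) l (\<lambda>k. c k \<cdot>\<^sub>m w k)"
proof
  fix l assume l: "l \<in> {1..L}"
  let ?E = "emp_error \<sigma> b L loss S"
  have inv: "?E (\<lambda>k. c k \<cdot>\<^sub>m u k) = ?E u" if u: "weights L n u" for u
  proof -
    \<comment> \<open>The error sees the network only at training inputs, and these lie in the
      domain on which the two networks agree.\<close>
    have "network \<sigma> b L (\<lambda>k. c k \<cdot>\<^sub>m u k) x = network \<sigma> b L u x" if "(x, y) \<in> S" for x y
      using assms(7,10) u that by auto
    then show ?thesis
      unfolding emp_error_def by (intro arg_cong2[of _ _ _ _ "(*)"] sum.cong) auto
  qed
  show "flatness n ?E l w = flatness n ?E l (\<lambda>k. c k \<cdot>\<^sub>m w k)"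
  proof (rule flatness_smult)
    \<comment> \<open>Regularity is assumed at all admissible weights; here it is taken at the
      rescaled ones.\<close>
    show "twice_differentiable_vec (n l * n (l - 1)) (layer_error n ?E l (\<lambda>k. c k \<cdot>\<^sub>m w k))"
      using assms(8) weights_smult[OF assms(11)] l by blast
    show "n l * n (l - 1) > 0" using assms(2) l by auto
  qed (use inv assms(9,11) l in auto)
qed

end
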